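(* Let $G$ be a compact Lie group with root system $R$, positive roots $R^+$, simple roots $S=\{\alpha_1,\ldots,\alpha_n\}$, Weyl group $W$ and Dynkin diagram $\Gamma$, and let $j\in\{1,\ldots,n\}$. A sequence of moves of the modified Kostant game at the vertex $j$ on the Dynkin diagram of coroots of $\Gamma$ encodes a reduced expression of some element of $W^j$: if $(i_1,i_2,\ldots,i_t)$ lists the vertices at which the successive moves of the game are made, then $s_{i_t}\cdots s_{i_2}s_{i_1}$ is a reduced expression of an element of $W^j$. Conversely, every reduced expression of an element of $W^j$ can be obtained in this way.
   Context: $R$ is a (reduced, crystallographic) root system with simple roots $\alpha_1,\dots,\alpha_n$; $\check\alpha=2\alpha/(\alpha,\alpha)$ denotes the coroot of $\alpha$ and $s_i$ the simple reflection of $\alpha_i$; $\langle x,\check\alpha\rangle=2(x,\alpha)/(\alpha,\alpha)$. The length $l(w)$ of $w\in W$ is the smallest number of simple reflections in an expression of $w$ as a product of simple reflections, and an expression of that length is called reduced. The inversion set of $w$ is $I(w)=\{\alpha\in R^+\mid w(\alpha)\in -R^+\}$. Let $R_j^+$ be the set of positive roots spanned by $\{\alpha_i\}_{i\ne j}$ and $W_j$ the subgroup generated by $\{s_i\}_{i\ne j}$. The set of minimal length representatives of $W/W_j$ is $W^j=\{w\in W\mid I(w)\subset R^+\setminus R_j^+\}$. Modified Kostant game at the vertex $j$ on a Dynkin diagram with vertices $1,\ldots,n$: for a diagram with simple roots $a_1,\ldots,a_n$, let $n_{i,m}=-\langle a_m,\check a_i\rangle$ for adjacent vertices $i,m$,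 and let $N(i)$ be the set of neighbours of $i$. Add a new vertex $\tilde j$ adjacent only to $j$, with one arrow from $\tilde j$ to $j$. The vertex $\tilde j$ always carries exactly one chip and is declared always happy. A configuration consists of this chip together with $c_i\in\mathbb Z_{\ge0}$ chips at each vertex $i$. The game starts with $c_1=\cdots=c_n=0$. A vertex $i\in\{1,\dots,n\}$ is unhappy if $2c_i<\delta_{ij}+\sum_{m\in N(i)}n_{i,m}c_m$. A move consists of choosing an unhappy vertex $i$ and replacing $c_i$ by $-c_i+\delta_{ij}+\sum_{m\in N(i)}n_{i,m}c_m$, leaving the other entries unchanged. Here the game is played on the Dynkin diagram of coroots of $\Gamma$, i.e. the diagram of the simple coroots $\check\alpha_1,\ldots,\check\alpha_n$ (the dual root system), so that the coefficients $n_{i,m}$ used are $-\langle\alpha_i,\check\alpha_m\rangle$. *)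

theory Defs
  imports "HOL-Analysis.Analysis"
begin

section \<open>Root systems\<close>

definition coroot :: "'a::euclidean_space \<Rightarrow> 'a" where
  "coroot \<beta> = (2 / (\<beta> \<bullet> \<beta>)) *\<^sub>R \<beta>"

definition pairing :: "'a::euclidean_space \<Rightarrow> 'a \<Rightarrow> real" where
  "pairing x \<beta> = x \<bullet> coroot \<beta>"

definition reflection :: "'a::euclidean_space \<Rightarrow> 'a \<Rightarrow> 'a" where
  "reflection \<beta> x = x - pairing x \<beta> *\<^sub>R \<beta>"

text \<open>
  Reduced crystallographic root systems.  The roots are not required to span the ambient
  space, since the roots of a compact group with centre of positive dimension do not; so
  \<open>R\<close> is a root system in \<open>span R\<close>, and reflections fix the orthogonal complement.
\<close>
definition root_system :: "'a::euclidean_space set \<Rightarrow> bool" where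
  "root_system R \<longleftrightarrow>
     finite R \<and> 0 \<notin> R \<and>
     (\<forall>\<beta>\<in>R. reflection \<beta> ` R = R) \<and>
     (\<forall>\<beta>\<in>R. \<forall>\<gamma>\<in>R. pairing \<gamma> \<beta> \<in> \<int>) \<and>
     (\<forall>\<beta>\<in>R. R \<inter> range (\<lambda>t. t *\<^sub>R \<beta>) = {\<beta>, - \<beta>})"

definition simple_roots :: "'a::euclidean_space set \<Rightarrow> nat \<Rightarrow> (nat \<Rightarrow> 'a) \<Rightarrow> bool" where
  "simple_roots R n \<alpha> \<longleftrightarrow>
     \<alpha> ` {1..n} \<subseteq> R \<and> inj_on \<alpha> {1..n} \<and> independent (\<alpha> ` {1..n}) \<and>
     (\<forall>\<beta>\<in>R. \<exists>k :: nat \<Rightarrow> int.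
        \<beta> = (\<Sum>i\<in>{1..n}. of_int (k i) *\<^sub>R \<alpha> i) \<and>
        ((\<forall>i\<in>{1..n}. k i \<ge> 0) \<or> (\<forall>i\<in>{1..n}. k i \<le> 0)))"

definition positive_roots :: "'a::euclidean_space set \<Rightarrow> nat \<Rightarrow> (nat \<Rightarrow> 'a) \<Rightarrow> 'a set" where
  "positive_roots R n \<alpha> =
     {\<beta>\<in>R. \<exists>k :: nat \<Rightarrow> nat. \<beta> = (\<Sum>i\<in>{1..n}. of_nat (k i) *\<^sub>R \<alpha> i)}"

section \<open>The Weyl group\<close>

text \<open>Reflections are involutions, so the monoid they generate is already a group.\<close>
inductive_set weyl_group :: "'a::euclidean_space set \<Rightarrow> ('a \<Rightarrow> 'a) set"
  for R :: "'a set" where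
  weyl_id: "id \<in> weyl_group R"
| weyl_refl: "w \<in> weyl_group R \<Longrightarrow> \<beta> \<in> R \<Longrightarrow> reflection \<beta> \<circ> w \<in> weyl_group R"

text \<open>\<open>word_product \<alpha> [k\<^sub>1, \<dots>, k\<^sub>t]\<close> is the composition whose leftmost factor is the
  reflection in \<open>\<alpha> k\<^sub>1\<close>, i.e. the one applied last.\<close>
definition word_product :: "(nat \<Rightarrow> 'a::euclidean_space) \<Rightarrow> nat list \<Rightarrow> 'a \<Rightarrow> 'a" where
  "word_product \<alpha> ks = foldr (\<lambda>i w. reflection (\<alpha> i) \<circ> w) ks id"

definition weyl_length :: "nat \<Rightarrow> (nat \<Rightarrow> 'a::euclidean_space) \<Rightarrow> ('a \<Rightarrow> 'a) \<Rightarrow> nat" where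
  "weyl_length n \<alpha> w =
     (LEAST t. \<exists>ks. set ks \<subseteq> {1..n} \<and> length ks = t \<and> word_product \<alpha> ks = w)"

definition reduced_expression ::
    "nat \<Rightarrow> (nat \<Rightarrow> 'a::euclidean_space) \<Rightarrow> nat list \<Rightarrow> ('a \<Rightarrow> 'a) \<Rightarrow> bool" where
  "reduced_expression n \<alpha> ks w \<longleftrightarrow>
     set ks \<subseteq> {1..n} \<and> word_product \<alpha> ks = w \<and> length ks = weyl_length n \<alpha> w"

definition inversion_set ::
    "'a::euclidean_space set \<Rightarrow> nat \<Rightarrow> (nat \<Rightarrow> 'a) \<Rightarrow> ('a \<Rightarrow> 'a) \<Rightarrow> 'a set" where
  "inversion_set R n \<alpha> w =
     {\<beta> \<in> positive_roots R n \<alpha>. w \<beta> \<in> uminus ` positive_roots R n \<alpha>}"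

definition parabolic_positive_roots ::
    "'a::euclidean_space set \<Rightarrow> nat \<Rightarrow> (nat \<Rightarrow> 'a) \<Rightarrow> nat \<Rightarrow> 'a set" where
  "parabolic_positive_roots R n \<alpha> j =
     positive_roots R n \<alpha> \<inter> span (\<alpha> ` ({1..n} - {j}))"

text \<open>The set \<open>W\<^sup>j\<close>.\<close>
definition minimal_representatives ::
    "'a::euclidean_space set \<Rightarrow> nat \<Rightarrow> (nat \<Rightarrow> 'a) \<Rightarrow> nat \<Rightarrow> ('a \<Rightarrow> 'a) set" where
  "minimal_representatives R n \<alpha> j =
     {w \<in> weyl_group R.
        inversion_set R n \<alpha> w \<subseteq> positive_roots R n \<alpha> - parabolic_positive_roots R n \<alpha> j}"

section \<open>The modified Kostant game\<close>

text \<open>Below, \<open>a\<close> is the family of simple roots of the diagram on which the game is played.\<close>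

definition neighbours :: "nat \<Rightarrow> (nat \<Rightarrow> 'a::euclidean_space) \<Rightarrow> nat \<Rightarrow> nat set" where
  "neighbours n a i = {m \<in> {1..n}. m \<noteq> i \<and> a m \<bullet> a i \<noteq> 0}"

text \<open>The first summand is the contribution of the single chip on the extra vertex attached
  to \<open>j\<close>; that vertex never moves, so it is not part of a configuration.\<close>
definition neighbour_chips ::
    "nat \<Rightarrow> (nat \<Rightarrow> 'a::euclidean_space) \<Rightarrow> nat \<Rightarrow> (nat \<Rightarrow> nat) \<Rightarrow> nat \<Rightarrow> real" where
  "neighbour_chips n a j c i =
     (if i = j then 1 else 0) + (\<Sum>m\<in>neighbours n a i. - pairing (a m) (a i) * of_nat (c m))"

definition unhappy ::
    "nat \<Rightarrow> (nat \<Rightarrow> 'a::euclidean_space) \<Rightarrow> nat \<Rightarrow> (nat \<Rightarrow> nat) \<Rightarrow> nat \<Rightarrow> bool" where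
  "unhappy n a j c i \<longleftrightarrow> i \<in> {1..n} \<and> 2 * of_nat (c i) < neighbour_chips n a j c i"

text \<open>The weights are integers for a Dynkin diagram, and at an unhappy vertex the prescribed
  new number of chips exceeds the old one; so it is a natural number and every unhappy vertex
  does admit a move.\<close>
definition game_move ::
    "nat \<Rightarrow> (nat \<Rightarrow> 'a::euclidean_space) \<Rightarrow> nat \<Rightarrow> (nat \<Rightarrow> nat) \<Rightarrow> nat \<Rightarrow> (nat \<Rightarrow> nat) \<Rightarrow> bool"
  where
  "game_move n a j c i c' \<longleftrightarrow>
     unhappy n a j c i \<and>
     of_nat (c' i) = - of_nat (c i) + neighbour_chips n a j c i \<and>
     (\<forall>m. m \<noteq> i \<longrightarrow> c' m = c m)"

text \<open>\<open>game_play n a j is c\<close>: successive moves at the vertices listed in \<open>is\<close>, in this order,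
  lead from the empty configuration to \<open>c\<close>.  The play need not be complete.\<close>
inductive game_play ::
    "nat \<Rightarrow> (nat \<Rightarrow> 'a::euclidean_space) \<Rightarrow> nat \<Rightarrow> nat list \<Rightarrow> (nat \<Rightarrow> nat) \<Rightarrow> bool"
  for n :: nat and a :: "nat \<Rightarrow> 'a" and j :: nat where
  game_start: "game_play n a j [] (\<lambda>_. 0)"
| game_step: "game_play n a j is c \<Longrightarrow> game_move n a j c i c' \<Longrightarrow> game_play n a j (is @ [i]) c'"

end

theory Submission
  imports Defs
begin

text \<open>
  The game is the action of the Weyl group on a single vector in disguise.  Let \<open>\<omega>\<close> be a
  fundamental coweight, \<open>\<omega> \<bullet> \<alpha> i = \<delta>\<^sub>i\<^sub>j\<close>, and read a configuration \<open>c\<close> as the vector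
  \<open>v = \<omega> - (\<Sum>m. c m *\<^sub>R coroot (\<alpha> m))\<close>.  Passing to the diagram of coroots transposes the
  Cartan matrix, so that the excess of (weighted) neighbouring chips over \<open>2 * c i\<close> is exactly
  \<open>v \<bullet> \<alpha> i\<close> (\<open>neighbour_chips_eq\<close>).  Hence \<open>i\<close> is unhappy iff \<open>v \<bullet> \<alpha> i > 0\<close>, and a move at \<open>i\<close>
  replaces \<open>v\<close> by its reflection in \<open>\<alpha> i\<close>.  After moves spelling the Weyl group element \<open>w\<close> the
  vector is \<open>w \<omega>\<close>, and the condition for the next move reads \<open>\<omega> \<bullet> w\<^sup>-\<^sup>1 (\<alpha> i) > 0\<close>: the root
  \<open>w\<^sup>-\<^sup>1 (\<alpha> i)\<close> is positive and involves \<open>\<alpha> j\<close>, that is, it lies in \<open>R\<^sup>+\<close> but not in \<open>R\<^sub>j\<^sup>+\<close>.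

  Now if \<open>w\<^sup>-\<^sup>1 (\<alpha> i)\<close> is positive, then the inversions of \<open>s\<^sub>i w\<close> are those of \<open>w\<close>
  together with this one new root (\<open>inversion_set_extend\<close>).  So every move adds one inversion
  outside \<open>R\<^sub>j\<^sup>+\<close>; the element stays in \<open>W\<^sup>j\<close>, and it has as many inversions as there were moves,
  which forces the expression to be reduced since a word of length \<open>t\<close> has at most \<open>t\<close> inversions.
  Conversely, the exchange argument (\<open>exchange\<close>) shows that in a reduced expression
  \<open>s\<^sub>i w\<close> the root \<open>w\<^sup>-\<^sup>1 (\<alpha> i)\<close> is positive.  It is then an inversion of \<open>s\<^sub>i w\<close>, hence outside
  \<open>R\<^sub>j\<^sup>+\<close> when \<open>s\<^sub>i w\<close> is in \<open>W\<^sup>j\<close>, and this is precisely the permission to move at \<open>i\<close>.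
\<close>

section \<open>Reflections and words\<close>

lemma coroot_coroot: "coroot (coroot \<beta>) = \<beta>"
  by (cases "\<beta> = 0") (simp_all add: coroot_def)

lemma inner_coroot_self: "\<beta> \<noteq> 0 \<Longrightarrow> \<beta> \<bullet> coroot \<beta> = 2"
  by (simp add: coroot_def)

lemma linear_reflection: "linear (reflection \<beta>)"
  by (rule linearI) (simp_all add: reflection_def pairing_def algebra_simps)

lemma reflection_self: "\<beta> \<noteq> 0 \<Longrightarrow> reflection \<beta> \<beta> = - \<beta>"
  by (simp add: reflection_def pairing_def inner_coroot_self scaleR_2)

lemma reflection_minus: "reflection \<beta> (- x) = - reflection \<beta> x"
  by (simp add: linear_neg[OF linear_reflection])

lemma reflection_reflection: "reflection \<beta> (reflection \<beta> x) = x"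
  by (cases "\<beta> = 0") (simp_all add: reflection_def pairing_def coroot_def algebra_simps)

lemma reflection_swap: "reflection \<beta> x \<bullet> y = x \<bullet> reflection \<beta> y"
  by (simp add: reflection_def pairing_def coroot_def algebra_simps inner_commute)

text \<open>An isometry \<open>g\<close> conjugates the reflection in \<open>\<beta>\<close> into the reflection in \<open>g \<beta>\<close>; here
  \<open>g\<close> is the reflection in \<open>\<gamma>\<close>, which is its own inverse.\<close>
lemma reflection_conjugate:
  "reflection \<beta> \<circ> reflection \<gamma> = reflection \<gamma> \<circ> reflection (reflection \<gamma> \<beta>)"
proof
  fix x
  have norm: "reflection \<gamma> \<beta> \<bullet> reflection \<gamma> \<beta> = \<beta> \<bullet> \<beta>"
    by (simp add: reflection_swap reflection_reflection)
  have "pairing x (reflection \<gamma> \<beta>) = pairing (reflection \<gamma> x) \<beta>"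
    unfolding pairing_def coroot_def norm by (simp add: reflection_swap)
  then have "reflection \<gamma> (reflection (reflection \<gamma> \<beta>) x)
      = reflection \<gamma> (x - pairing (reflection \<gamma> x) \<beta> *\<^sub>R reflection \<gamma> \<beta>)"
    by (simp add: reflection_def[of "reflection \<gamma> \<beta>"])
  also have "\<dots> = reflection \<beta> (reflection \<gamma> x)"
    by (simp add: linear_diff[OF linear_reflection] linear_scale[OF linear_reflection]
        reflection_reflection reflection_def[of \<beta>])
  finally show "(reflection \<beta> \<circ> reflection \<gamma>) x
      = (reflection \<gamma> \<circ> reflection (reflection \<gamma> \<beta>)) x" by simp
qed

lemma word_product_Nil [simp]: "word_product \<alpha> [] = id"
  by (simp add: word_product_def)

lemma word_product_Cons [simp]:
  "word_product \<alpha> (i # ks) = reflection (\<alpha> i) \<circ> word_product \<alpha> ks"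
  by (simp add: word_product_def)

lemma word_product_append:
  "word_product \<alpha> (ks @ ls) = word_product \<alpha> ks \<circ> word_product \<alpha> ls"
  by (induction ks) (simp_all add: comp_assoc)

lemma word_product_rev_inverse: "word_product \<alpha> (rev ks) (word_product \<alpha> ks x) = x"
  by (induction ks arbitrary: x) (simp_all add: word_product_append reflection_reflection)

lemma word_product_inverse_rev: "word_product \<alpha> ks (word_product \<alpha> (rev ks) x) = x"
  using word_product_rev_inverse[of \<alpha> "rev ks"] by simp

lemma word_product_swap: "word_product \<alpha> ks x \<bullet> y = x \<bullet> word_product \<alpha> (rev ks) y"
  by (induction ks arbitrary: y) (simp_all add: word_product_append reflection_swap)

lemma word_product_minus: "word_product \<alpha> ks (- x) = - word_product \<alpha> ks x"
  by (induction ks) (simp_all add: reflection_minus)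

lemma weyl_length_le:
  assumes "set ks \<subseteq> {1..n}"
  shows "weyl_length n \<alpha> (word_product \<alpha> ks) \<le> length ks"
  unfolding weyl_length_def by (rule Least_le) (use assms in blast)

lemma weyl_length_attained:
  assumes "set ks \<subseteq> {1..n}"
  obtains ls where "set ls \<subseteq> {1..n}" "word_product \<alpha> ls = word_product \<alpha> ks"
    "length ls = weyl_length n \<alpha> (word_product \<alpha> ks)"
proof -
  have "\<exists>ls. set ls \<subseteq> {1..n} \<and> length ls = weyl_length n \<alpha> (word_product \<alpha> ks)
      \<and> word_product \<alpha> ls = word_product \<alpha> ks"
    unfolding weyl_length_def by (rule LeastI_ex) (use assms in blast)
  then show thesis using that by blast
qed

lemma reduced_expression_tail:
  assumes "reduced_expression n \<alpha> (i # ks) w"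
  shows "reduced_expression n \<alpha> ks (word_product \<alpha> ks)"
proof -
  have ks: "i \<in> {1..n}" "set ks \<subseteq> {1..n}" and w: "w = word_product \<alpha> (i # ks)"
    and len: "Suc (length ks) = weyl_length n \<alpha> w"
    using assms by (auto simp: reduced_expression_def)
  obtain ls where ls: "set ls \<subseteq> {1..n}" "word_product \<alpha> ls = word_product \<alpha> ks"
    "length ls = weyl_length n \<alpha> (word_product \<alpha> ks)"
    using weyl_length_attained[OF ks(2)] .
  have "word_product \<alpha> (i # ls) = w" using ls(2) w by simp
  then have "weyl_length n \<alpha> w \<le> Suc (length ls)"
    using weyl_length_le[of "i # ls" n \<alpha>] ls(1) ks(1) by simp
  moreover have "weyl_length n \<alpha> (word_product \<alpha> ks) \<le> length ks"
    by (rule weyl_length_le[OF ks(2)])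
  ultimately show ?thesis
    using ks len ls(3) by (simp add: reduced_expression_def)
qed

section \<open>Positive roots and inversions\<close>

locale based_root_system =
  fixes R :: "'a::euclidean_space set" and n :: nat and \<alpha> :: "nat \<Rightarrow> 'a"
  assumes root_system: "root_system R"
    and simple_roots: "simple_roots R n \<alpha>"
begin

abbreviation "P \<equiv> positive_roots R n \<alpha>"

text \<open>The inner product with this vector reads off the coefficient of \<open>\<alpha> m\<close>, so that signs of
  roots become signs of inner products.  When the roots do not span the space the vector is
  determined only up to their orthogonal complement; a choice is made because only its inner
  products with roots matter.\<close>
definition fundamental_coweight :: "nat \<Rightarrow> 'a" where
  "fundamental_coweight m =
     (SOME \<omega>. \<forall>i\<in>{1..n}. \<omega> \<bullet> \<alpha> i = (if i = m then 1 else 0))"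

lemma coweight_simple:
  assumes "i \<in> {1..n}"
  shows "fundamental_coweight m \<bullet> \<alpha> i = (if i = m then 1 else 0)"
proof -
  have inj: "inj_on \<alpha> {1..n}" and ind: "independent (\<alpha> ` {1..n})"
    using simple_roots by (auto simp: simple_roots_def)
  define g where "g x = (if the_inv_into {1..n} \<alpha> x = m then 1 else 0 :: real)" for x
  obtain f :: "'a \<Rightarrow> real" where f: "linear f" "\<forall>x\<in>\<alpha> ` {1..n}. f x = g x"
    using linear_independent_extend[OF ind] by blast
  have "adjoint f 1 \<bullet> \<alpha> i = (if i = m then 1 else 0)" if "i \<in> {1..n}" for i
    using that f(2) adjoint_works[OF f(1), of "\<alpha> i" 1]
    by (simp add: g_def the_inv_into_f_f[OF inj that] inner_commute del: One_nat_def)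
  then have "\<exists>\<omega>. \<forall>i\<in>{1..n}. \<omega> \<bullet> \<alpha> i = (if i = m then 1 else 0)" by blast
  from someI_ex[OF this] show ?thesis
    using assms unfolding fundamental_coweight_def by blast
qed

lemma coweight_combination:
  assumes "m \<in> {1..n}"
  shows "fundamental_coweight m \<bullet> (\<Sum>i\<in>{1..n}. k i *\<^sub>R \<alpha> i) = k m"
proof -
  have "fundamental_coweight m \<bullet> (\<Sum>i\<in>{1..n}. k i *\<^sub>R \<alpha> i)
      = (\<Sum>i\<in>{1..n}. if i = m then k i else 0)"
    unfolding inner_sum_right by (rule sum.cong) (simp_all add: coweight_simple)
  then show ?thesis using assms by simp
qed

lemma positive_root_is_root: "\<beta> \<in> P \<Longrightarrow> \<beta> \<in> R"
  by (simp add: positive_roots_def)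

lemma root_nonzero: "\<beta> \<in> R \<Longrightarrow> \<beta> \<noteq> 0"
  using root_system by (auto simp: root_system_def)

lemma reflection_root: "\<beta> \<in> R \<Longrightarrow> \<gamma> \<in> R \<Longrightarrow> reflection \<beta> \<gamma> \<in> R"
  using root_system by (auto simp: root_system_def)

lemma minus_root: "\<beta> \<in> R \<Longrightarrow> - \<beta> \<in> R"
  using reflection_root[of \<beta> \<beta>] by (simp add: reflection_self root_nonzero)

lemma simple_is_root: "i \<in> {1..n} \<Longrightarrow> \<alpha> i \<in> R"
  using simple_roots by (auto simp: simple_roots_def)

lemma finite_positive_roots: "finite P"
  using root_system by (simp add: root_system_def positive_roots_def)

lemma positive_root_expansion:
  assumes "\<beta> \<in> P"
  shows "\<beta> = (\<Sum>i\<in>{1..n}. (fundamental_coweight i \<bullet> \<beta>) *\<^sub>R \<alpha> i)"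
    and "m \<in> {1..n} \<Longrightarrow> fundamental_coweight m \<bullet> \<beta> \<ge> 0"
proof -
  obtain k :: "nat \<Rightarrow> nat" where k: "\<beta> = (\<Sum>i\<in>{1..n}. of_nat (k i) *\<^sub>R \<alpha> i)"
    using assms by (auto simp: positive_roots_def)
  have c: "fundamental_coweight m \<bullet> \<beta> = of_nat (k m)" if "m \<in> {1..n}" for m
    unfolding k using coweight_combination[OF that] .
  then show "m \<in> {1..n} \<Longrightarrow> fundamental_coweight m \<bullet> \<beta> \<ge> 0" by simp
  have "(\<Sum>i\<in>{1..n}. (fundamental_coweight i \<bullet> \<beta>) *\<^sub>R \<alpha> i)
      = (\<Sum>i\<in>{1..n}. of_nat (k i) *\<^sub>R \<alpha> i)"
    by (rule sum.cong) (simp_all add: c)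
  then show "\<beta> = (\<Sum>i\<in>{1..n}. (fundamental_coweight i \<bullet> \<beta>) *\<^sub>R \<alpha> i)" using k by simp
qed

lemma positive_or_negative:
  assumes "\<beta> \<in> R"
  shows "\<beta> \<in> P \<or> - \<beta> \<in> P"
proof -
  obtain k :: "nat \<Rightarrow> int" where k: "\<beta> = (\<Sum>i\<in>{1..n}. of_int (k i) *\<^sub>R \<alpha> i)"
    and sgn: "(\<forall>i\<in>{1..n}. k i \<ge> 0) \<or> (\<forall>i\<in>{1..n}. k i \<le> 0)"
    using assms simple_roots unfolding simple_roots_def by blast
  from sgn show ?thesis
  proof
    assume "\<forall>i\<in>{1..n}. k i \<ge> 0"
    then have "\<beta> = (\<Sum>i\<in>{1..n}. of_nat (nat (k i)) *\<^sub>R \<alpha> i)"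
      unfolding k by (intro sum.cong) simp_all
    then show ?thesis using assms by (auto simp: positive_roots_def)
  next
    assume "\<forall>i\<in>{1..n}. k i \<le> 0"
    then have "- \<beta> = (\<Sum>i\<in>{1..n}. of_nat (nat (- k i)) *\<^sub>R \<alpha> i)"
      unfolding k sum_negf[symmetric] by (intro sum.cong) simp_all
    then show ?thesis using minus_root[OF assms] by (auto simp: positive_roots_def)
  qed
qed

lemma positive_iff_coweight:
  assumes "\<beta> \<in> R"
  shows "\<beta> \<in> P \<longleftrightarrow> (\<exists>m\<in>{1..n}. fundamental_coweight m \<bullet> \<beta> > 0)"
proof
  assume b: "\<beta> \<in> P"
  show "\<exists>m\<in>{1..n}. fundamental_coweight m \<bullet> \<beta> > 0"
  proof (rule ccontr)
    assume "\<not> ?thesis"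
    then have z: "fundamental_coweight m \<bullet> \<beta> = 0" if "m \<in> {1..n}" for m
      using that positive_root_expansion(2)[OF b that] by force
    have "\<beta> = (\<Sum>i\<in>{1..n}. 0 *\<^sub>R \<alpha> i)"
      by (subst positive_root_expansion(1)[OF b], rule sum.cong) (simp_all only: z)
    then show False using root_nonzero[OF assms] by simp
  qed
next
  assume "\<exists>m\<in>{1..n}. fundamental_coweight m \<bullet> \<beta> > 0"
  then obtain m where m: "m \<in> {1..n}" "fundamental_coweight m \<bullet> \<beta> > 0" by blast
  then have "- \<beta> \<notin> P" using positive_root_expansion(2)[of "- \<beta>" m] by auto
  then show "\<beta> \<in> P" using positive_or_negative[OF assms] by blast
qed

lemma not_positive_and_negative:
  assumes "\<beta> \<in> P" shows "- \<beta> \<notin> P"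
proof
  assume "- \<beta> \<in> P"
  obtain m where m: "m \<in> {1..n}" "fundamental_coweight m \<bullet> \<beta> > 0"
    using assms positive_iff_coweight positive_root_is_root by blast
  then show False using positive_root_expansion(2)[OF \<open>- \<beta> \<in> P\<close> m(1)] by simp
qed

lemma simple_positive: "i \<in> {1..n} \<Longrightarrow> \<alpha> i \<in> P"
  using positive_iff_coweight[OF simple_is_root] coweight_simple[of i i] by force

text \<open>A simple reflection changes only one coefficient, and a positive root that is not a
  multiple of \<open>\<alpha> i\<close> has another, positive, coefficient witnessing its sign.\<close>
lemma simple_reflection_positive:
  assumes "i \<in> {1..n}" "\<beta> \<in> P" "\<beta> \<noteq> \<alpha> i"
  shows "reflection (\<alpha> i) \<beta> \<in> P"
proof -
  have R: "\<beta> \<in> R" "\<alpha> i \<in> R" using assms positive_root_is_root simple_is_root by auto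
  have "\<exists>m\<in>{1..n} - {i}. fundamental_coweight m \<bullet> \<beta> > 0"
  proof (rule ccontr)
    assume "\<not> ?thesis"
    then have z: "fundamental_coweight m \<bullet> \<beta> = 0" if "m \<in> {1..n}" "m \<noteq> i" for m
      using that positive_root_expansion(2)[OF assms(2) that(1)] by force
    have "\<beta> = (\<Sum>m\<in>{1..n}. (fundamental_coweight m \<bullet> \<beta>) *\<^sub>R \<alpha> m)"
      by (rule positive_root_expansion(1)[OF assms(2)])
    also have "\<dots> = (\<Sum>m\<in>{1..n}. if m = i then (fundamental_coweight m \<bullet> \<beta>) *\<^sub>R \<alpha> m else 0)"
      by (rule sum.cong) (auto simp: z)
    also have "\<dots> = (fundamental_coweight i \<bullet> \<beta>) *\<^sub>R \<alpha> i" using assms(1) by simp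
    finally have "\<beta> \<in> range (\<lambda>t. t *\<^sub>R \<alpha> i)" by blast
    moreover have "R \<inter> range (\<lambda>t. t *\<^sub>R \<alpha> i) = {\<alpha> i, - \<alpha> i}"
      using R(2) root_system by (simp add: root_system_def)
    ultimately have "\<beta> = \<alpha> i \<or> \<beta> = - \<alpha> i" using R(1) by blast
    then show False
      using assms not_positive_and_negative[OF simple_positive[OF assms(1)]] by auto
  qed
  then obtain m where m: "m \<in> {1..n}" "m \<noteq> i" "fundamental_coweight m \<bullet> \<beta> > 0" by blast
  then have "fundamental_coweight m \<bullet> reflection (\<alpha> i) \<beta> > 0"
    using coweight_simple[OF assms(1), of m] by (simp add: reflection_def inner_diff_right)
  then show ?thesis using positive_iff_coweight reflection_root R m(1) by blast
qed

lemma parabolic_positive_iff: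
  assumes "\<beta> \<in> P" "j \<in> {1..n}"
  shows "\<beta> \<in> parabolic_positive_roots R n \<alpha> j \<longleftrightarrow> fundamental_coweight j \<bullet> \<beta> = 0"
proof
  assume "\<beta> \<in> parabolic_positive_roots R n \<alpha> j"
  then have "\<beta> \<in> span (\<alpha> ` ({1..n} - {j}))" by (simp add: parabolic_positive_roots_def)
  then have "orthogonal (fundamental_coweight j) \<beta>"
    by (rule orthogonal_to_span) (auto simp: orthogonal_def coweight_simple split: if_splits)
  then show "fundamental_coweight j \<bullet> \<beta> = 0" by (simp add: orthogonal_def)
next
  assume z: "fundamental_coweight j \<bullet> \<beta> = 0"
  have "(\<Sum>i\<in>{1..n}. (fundamental_coweight i \<bullet> \<beta>) *\<^sub>R \<alpha> i) \<in> span (\<alpha> ` ({1..n} - {j}))"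
  proof (rule span_sum)
    fix i assume "i \<in> {1..n}"
    then show "(fundamental_coweight i \<bullet> \<beta>) *\<^sub>R \<alpha> i \<in> span (\<alpha> ` ({1..n} - {j}))"
      using z by (cases "i = j") (simp_all add: span_zero span_scale span_base)
  qed
  then show "\<beta> \<in> parabolic_positive_roots R n \<alpha> j"
    using assms(1) positive_root_expansion(1)[OF assms(1)]
    by (simp add: parabolic_positive_roots_def)
qed

lemma word_product_root:
  assumes "set ks \<subseteq> {1..n}" "\<beta> \<in> R" shows "word_product \<alpha> ks \<beta> \<in> R"
  using assms(1) by (induction ks) (simp_all add: assms(2) reflection_root simple_is_root)

lemma word_product_in_weyl_group:
  "set ks \<subseteq> {1..n} \<Longrightarrow> word_product \<alpha> ks \<in> weyl_group R"
  by (induction ks) (simp_all add: weyl_id weyl_refl simple_is_root)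

lemma inversion_iff:
  "\<gamma> \<in> inversion_set R n \<alpha> w \<longleftrightarrow> \<gamma> \<in> P \<and> - w \<gamma> \<in> P"
  unfolding inversion_set_def by (auto simp: image_iff) (metis minus_minus)

lemma finite_inversion_set: "finite (inversion_set R n \<alpha> w)"
  by (rule finite_subset[OF _ finite_positive_roots]) (auto simp: inversion_set_def)

lemma inversion_set_Cons_subset:
  assumes "i \<in> {1..n}" "set ks \<subseteq> {1..n}"
  shows "inversion_set R n \<alpha> (word_product \<alpha> (i # ks))
    \<subseteq> insert (word_product \<alpha> (rev ks) (\<alpha> i)) (inversion_set R n \<alpha> (word_product \<alpha> ks))"
proof
  fix \<gamma> assume "\<gamma> \<in> inversion_set R n \<alpha> (word_product \<alpha> (i # ks))"
  then have g: "\<gamma> \<in> P" "- reflection (\<alpha> i) (word_product \<alpha> ks \<gamma>) \<in> P"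
    by (auto simp: inversion_iff)
  show "\<gamma> \<in> insert (word_product \<alpha> (rev ks) (\<alpha> i)) (inversion_set R n \<alpha> (word_product \<alpha> ks))"
  proof (cases "- word_product \<alpha> ks \<gamma> \<in> P")
    case True
    then show ?thesis using g by (simp add: inversion_iff)
  next
    case False
    then have "word_product \<alpha> ks \<gamma> \<in> P"
      using word_product_root[OF assms(2)] positive_or_negative g(1) positive_root_is_root
      by blast
    then have "word_product \<alpha> ks \<gamma> = \<alpha> i"
      using simple_reflection_positive[OF assms(1)] not_positive_and_negative g(2) by blast
    then have "\<gamma> = word_product \<alpha> (rev ks) (\<alpha> i)"
      using word_product_rev_inverse[of \<alpha> ks \<gamma>] by simp
    then show ?thesis by simp
  qed
qed

text \<open>This bound gives the lower estimate for the length of a Weyl group element: every word for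
  it has at least as many letters as the element has inversions.\<close>
lemma card_inversion_set_le:
  assumes "set ks \<subseteq> {1..n}"
  shows "card (inversion_set R n \<alpha> (word_product \<alpha> ks)) \<le> length ks"
  using assms
proof (induction ks)
  case Nil
  have "inversion_set R n \<alpha> id = {}"
    using not_positive_and_negative by (auto simp: inversion_iff)
  then show ?case by (simp add: id_def)
next
  case (Cons i ks)
  let ?I = "inversion_set R n \<alpha> (word_product \<alpha> ks)"
  have "card (inversion_set R n \<alpha> (word_product \<alpha> (i # ks)))
      \<le> card (insert (word_product \<alpha> (rev ks) (\<alpha> i)) ?I)"
    using Cons.prems by (intro card_mono inversion_set_Cons_subset) (auto simp: finite_inversion_set)
  also have "\<dots> \<le> Suc (card ?I)" by (rule card_insert_le_m1) simp_all
  finally show ?case using Cons by (simp add: comp_def)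
qed

text \<open>Writing \<open>w\<close> for the product of \<open>ks\<close>, the new root is \<open>w\<^sup>-\<^sup>1 (\<alpha> i)\<close>.  No old inversion is
  lost: a simple reflection could only make the negative root \<open>w \<gamma>\<close> positive if \<open>w \<gamma> = - \<alpha> i\<close>,
  which would make \<open>w\<^sup>-\<^sup>1 (\<alpha> i)\<close> negative.\<close>
lemma inversion_set_extend:
  assumes "i \<in> {1..n}" "set ks \<subseteq> {1..n}" "word_product \<alpha> (rev ks) (\<alpha> i) \<in> P"
  shows "inversion_set R n \<alpha> (word_product \<alpha> (i # ks))
      = insert (word_product \<alpha> (rev ks) (\<alpha> i)) (inversion_set R n \<alpha> (word_product \<alpha> ks))"
    and "word_product \<alpha> (rev ks) (\<alpha> i) \<notin> inversion_set R n \<alpha> (word_product \<alpha> ks)"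
proof -
  let ?\<beta> = "word_product \<alpha> (rev ks) (\<alpha> i)"
  have wb: "word_product \<alpha> ks ?\<beta> = \<alpha> i" by (rule word_product_inverse_rev)
  show "?\<beta> \<notin> inversion_set R n \<alpha> (word_product \<alpha> ks)"
    using not_positive_and_negative[OF simple_positive[OF assms(1)]]
    by (simp add: inversion_iff wb)
  have new: "?\<beta> \<in> inversion_set R n \<alpha> (word_product \<alpha> (i # ks))"
    using assms simple_positive root_nonzero simple_is_root
    by (simp add: inversion_iff wb reflection_self)
  have old: "\<gamma> \<in> inversion_set R n \<alpha> (word_product \<alpha> (i # ks))"
    if "\<gamma> \<in> inversion_set R n \<alpha> (word_product \<alpha> ks)" for \<gamma>
  proof -
    have g: "\<gamma> \<in> P" "- word_product \<alpha> ks \<gamma> \<in> P" using that by (auto simp: inversion_iff)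
    have "- word_product \<alpha> ks \<gamma> \<noteq> \<alpha> i"
    proof
      assume "- word_product \<alpha> ks \<gamma> = \<alpha> i"
      then have "?\<beta> = - \<gamma>"
        using word_product_rev_inverse[of \<alpha> ks "- \<gamma>"] by (simp add: word_product_minus)
      then show False using assms(3) not_positive_and_negative g(1) by simp
    qed
    then have "reflection (\<alpha> i) (- word_product \<alpha> ks \<gamma>) \<in> P"
      using simple_reflection_positive assms(1) g(2) by blast
    then show ?thesis using g(1) by (simp add: inversion_iff reflection_minus)
  qed
  show "inversion_set R n \<alpha> (word_product \<alpha> (i # ks))
      = insert ?\<beta> (inversion_set R n \<alpha> (word_product \<alpha> ks))"
    using inversion_set_Cons_subset[OF assms(1,2)] new old by blast
qed

text \<open>Apply the letters of the word one after the other to the positive root \<open>\<beta>\<close>.  A simple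
  reflection makes a positive root negative only if that root is its own simple root, and at the
  letter where the sign changes the transported reflection cancels the letter.\<close>
lemma exchange:
  assumes "set ks \<subseteq> {1..n}" "\<beta> \<in> P" "word_product \<alpha> (rev ks) \<beta> \<notin> P"
  shows "\<exists>ls. set ls \<subseteq> {1..n} \<and> length ls < length ks
    \<and> word_product \<alpha> ls = reflection \<beta> \<circ> word_product \<alpha> ks"
  using assms
proof (induction ks arbitrary: \<beta>)
  case Nil
  then show ?case by simp
next
  case (Cons k ks)
  show ?case
  proof (cases "\<beta> = \<alpha> k")
    case True
    then show ?thesis using Cons.prems
      by (intro exI[of _ ks]) (simp add: fun_eq_iff reflection_reflection)
  next
    case False
    then have "reflection (\<alpha> k) \<beta> \<in> P"
      using simple_reflection_positive Cons.prems by simp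
    moreover have "word_product \<alpha> (rev ks) (reflection (\<alpha> k) \<beta>) \<notin> P"
      using Cons.prems(3) by (simp add: word_product_append)
    ultimately obtain ls where ls: "set ls \<subseteq> {1..n}" "length ls < length ks"
      "word_product \<alpha> ls = reflection (reflection (\<alpha> k) \<beta>) \<circ> word_product \<alpha> ks"
      using Cons.IH[of "reflection (\<alpha> k) \<beta>"] Cons.prems(1) by (auto simp: comp_def)
    have "word_product \<alpha> (k # ls) = reflection \<beta> \<circ> word_product \<alpha> (k # ks)"
      using reflection_conjugate[of \<beta> "\<alpha> k"] by (simp add: ls(3) comp_assoc[symmetric])
    then show ?thesis using ls(1,2) Cons.prems(1) by (intro exI[of _ "k # ls"]) simp
  qed
qed

lemma reduced_expression_Cons_positive:
  assumes "reduced_expression n \<alpha> (i # ks) w"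
  shows "word_product \<alpha> (rev ks) (\<alpha> i) \<in> P"
proof (rule ccontr)
  assume neg: "\<not> ?thesis"
  have ks: "i \<in> {1..n}" "set ks \<subseteq> {1..n}" "w = word_product \<alpha> (i # ks)"
    "Suc (length ks) = weyl_length n \<alpha> w"
    using assms by (auto simp: reduced_expression_def)
  obtain ls where "set ls \<subseteq> {1..n}" "length ls < length ks" "word_product \<alpha> ls = w"
    using exchange[OF ks(2) simple_positive[OF ks(1)] neg] ks(3) by auto
  then show False using weyl_length_le[of ls n \<alpha>] ks(4) by simp
qed

lemma inversions_reduced:
  assumes "set ks \<subseteq> {1..n}" "card (inversion_set R n \<alpha> (word_product \<alpha> ks)) = length ks"
  shows "reduced_expression n \<alpha> ks (word_product \<alpha> ks)"
proof -
  obtain ls where ls: "set ls \<subseteq> {1..n}" "word_product \<alpha> ls = word_product \<alpha> ks"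
    "length ls = weyl_length n \<alpha> (word_product \<alpha> ks)"
    using weyl_length_attained[OF assms(1)] .
  then have "length ks \<le> weyl_length n \<alpha> (word_product \<alpha> ks)"
    using card_inversion_set_le[OF ls(1)] assms(2) by simp
  then show ?thesis
    using weyl_length_le[OF assms(1), of \<alpha>] assms(1) by (simp add: reduced_expression_def)
qed

section \<open>Configurations as vectors\<close>

definition configuration_vector :: "nat \<Rightarrow> (nat \<Rightarrow> nat) \<Rightarrow> 'a" where
  "configuration_vector j c
     = fundamental_coweight j - (\<Sum>m\<in>{1..n}. of_nat (c m) *\<^sub>R coroot (\<alpha> m))"

abbreviation "chips \<equiv> neighbour_chips n (\<lambda>i. coroot (\<alpha> i))"

text \<open>The pairing of \<open>coroot (\<alpha> m)\<close> with the coroot of \<open>coroot (\<alpha> i)\<close>, which is \<open>\<alpha> i\<close> again, is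
  linear in \<open>coroot (\<alpha> m)\<close>, so the sum over the neighbours is an inner product with \<open>\<alpha> i\<close>.
  Vertices not adjacent to \<open>i\<close> contribute zero to it, and \<open>2 * c i\<close> makes up for the diagonal
  term.\<close>
lemma neighbour_chips_eq:
  assumes "i \<in> {1..n}"
  shows "chips j c i = 2 * of_nat (c i) + configuration_vector j c \<bullet> \<alpha> i"
proof -
  let ?a = "\<lambda>i. coroot (\<alpha> i)"
  have entry: "pairing (?a m) (?a i) = ?a m \<bullet> \<alpha> i" for m
    by (simp add: pairing_def coroot_coroot)
  have "(\<Sum>m\<in>neighbours n ?a i. - pairing (?a m) (?a i) * of_nat (c m))
      = (\<Sum>m\<in>{1..n} - {i}. - (of_nat (c m) * (?a m \<bullet> \<alpha> i)))"
  proof (rule sum.mono_neutral_cong_left)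
    show "\<forall>m\<in>{1..n} - {i} - neighbours n ?a i. - (of_nat (c m) * (?a m \<bullet> \<alpha> i)) = 0"
      using root_nonzero[OF simple_is_root[OF assms]] by (auto simp: neighbours_def coroot_def)
  qed (auto simp: neighbours_def entry)
  moreover have "(\<Sum>m\<in>{1..n}. of_nat (c m) * (?a m \<bullet> \<alpha> i))
      = 2 * of_nat (c i) + (\<Sum>m\<in>{1..n} - {i}. of_nat (c m) * (?a m \<bullet> \<alpha> i))"
    using assms inner_coroot_self[OF root_nonzero[OF simple_is_root[OF assms]]]
    by (subst sum.remove[of _ i]) (simp_all add: inner_commute)
  ultimately show ?thesis
    using coweight_simple[OF assms, of j]
    by (simp add: neighbour_chips_def configuration_vector_def inner_diff_left inner_sum_left
        sum_negf)
qed

lemma unhappy_iff: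
  "unhappy n (\<lambda>i. coroot (\<alpha> i)) j c i \<longleftrightarrow> i \<in> {1..n} \<and> configuration_vector j c \<bullet> \<alpha> i > 0"
  by (auto simp: unhappy_def neighbour_chips_eq)

lemma move_reflects:
  assumes "game_move n (\<lambda>i. coroot (\<alpha> i)) j c i c'"
  shows "configuration_vector j c' = reflection (\<alpha> i) (configuration_vector j c)"
proof -
  let ?v = "configuration_vector j c"
  have i: "i \<in> {1..n}" and eq: "of_nat (c' i) = - of_nat (c i) + chips j c i"
    and rest: "\<And>m. m \<noteq> i \<Longrightarrow> c' m = c m"
    using assms by (auto simp: game_move_def unhappy_def)
  have new: "of_nat (c' i) = of_nat (c i) + ?v \<bullet> \<alpha> i"
    using eq by (simp add: neighbour_chips_eq[OF i])
  have "(\<Sum>m\<in>{1..n}. of_nat (c' m) *\<^sub>R coroot (\<alpha> m))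
      = (of_nat (c i) + ?v \<bullet> \<alpha> i) *\<^sub>R coroot (\<alpha> i)
        + (\<Sum>m\<in>{1..n} - {i}. of_nat (c m) *\<^sub>R coroot (\<alpha> m))"
    using i by (subst sum.remove[of _ i]) (auto simp: new rest intro!: sum.cong)
  also have "\<dots> = (?v \<bullet> \<alpha> i) *\<^sub>R coroot (\<alpha> i) + (\<Sum>m\<in>{1..n}. of_nat (c m) *\<^sub>R coroot (\<alpha> m))"
    using i by (subst (2) sum.remove[of _ i]) (simp_all add: scaleR_add_left)
  finally have "configuration_vector j c' = ?v - (?v \<bullet> \<alpha> i) *\<^sub>R coroot (\<alpha> i)"
    by (simp add: configuration_vector_def)
  also have "\<dots> = reflection (\<alpha> i) ?v"
    by (simp add: reflection_def pairing_def coroot_def)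
  finally show ?thesis .
qed

lemma chips_integral:
  assumes "i \<in> {1..n}" shows "chips j c i \<in> \<int>"
proof -
  have "pairing (coroot (\<alpha> m)) (coroot (\<alpha> i)) \<in> \<int>" if "m \<in> {1..n}" for m
  proof -
    have "pairing (coroot (\<alpha> m)) (coroot (\<alpha> i)) = pairing (\<alpha> i) (\<alpha> m)"
      by (simp add: pairing_def coroot_coroot inner_commute)
    then show ?thesis
      using root_system simple_is_root assms that by (simp add: root_system_def)
  qed
  then show ?thesis
    unfolding neighbour_chips_def by (auto simp: neighbours_def intro!: Ints_add Ints_sum Ints_mult)
qed

lemma unhappy_moves:
  assumes "unhappy n (\<lambda>i. coroot (\<alpha> i)) j c i"
  obtains c' where "game_move n (\<lambda>i. coroot (\<alpha> i)) j c i c'"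
proof -
  have i: "i \<in> {1..n}" and less: "2 * of_nat (c i) < chips j c i"
    using assms by (auto simp: unhappy_def)
  obtain z :: int where z: "chips j c i = of_int z"
    using chips_integral[OF i] by (metis Ints_cases)
  have "int (2 * c i) < z" using less z
    by (metis of_int_less_iff of_int_of_nat_eq of_nat_mult of_nat_numeral)
  then have "real (nat (z - int (c i))) = - of_nat (c i) + chips j c i"
    using z by simp
  then have "game_move n (\<lambda>i. coroot (\<alpha> i)) j c i (c(i := nat (z - int (c i))))"
    using assms by (simp add: game_move_def)
  then show thesis by (rule that)
qed

lemma play_vector:
  assumes "game_play n (\<lambda>i. coroot (\<alpha> i)) j moves c"
  shows "set moves \<subseteq> {1..n}
    \<and> configuration_vector j c = word_product \<alpha> (rev moves) (fundamental_coweight j)"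
  using assms
proof induction
  case game_start
  then show ?case by (simp add: configuration_vector_def)
next
  case (game_step "is" c i c')
  then show ?case
    using move_reflects[OF game_step.hyps(2)] by (auto simp: game_move_def unhappy_def)
qed

section \<open>Plays and reduced expressions\<close>

lemma positive_coweight_iff:
  assumes "\<beta> \<in> R" "j \<in> {1..n}"
  shows "fundamental_coweight j \<bullet> \<beta> > 0 \<longleftrightarrow> \<beta> \<in> P - parabolic_positive_roots R n \<alpha> j"
  using positive_iff_coweight[OF assms(1)] assms(2) parabolic_positive_iff[of \<beta> j]
    positive_root_expansion(2)[of \<beta> j]
  by (auto simp: order_less_le)

text \<open>The configuration vector is \<open>w \<omega>\<close>, where \<open>w\<close> is the product of the reversed moves, and \<open>w\<close> is
  orthogonal; so \<open>w \<omega> \<bullet> \<alpha> i = \<omega> \<bullet> w\<^sup>-\<^sup>1 (\<alpha> i)\<close>, which is the coefficient of \<open>\<alpha> j\<close> in a root.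
  The moves in their order of play spell \<open>w\<^sup>-\<^sup>1\<close>.\<close>
lemma unhappy_after_play_iff:
  assumes "game_play n (\<lambda>i. coroot (\<alpha> i)) j moves c" "j \<in> {1..n}" "i \<in> {1..n}"
  shows "unhappy n (\<lambda>i. coroot (\<alpha> i)) j c i
    \<longleftrightarrow> word_product \<alpha> moves (\<alpha> i) \<in> P - parabolic_positive_roots R n \<alpha> j"
proof -
  have "configuration_vector j c \<bullet> \<alpha> i = fundamental_coweight j \<bullet> word_product \<alpha> moves (\<alpha> i)"
    using play_vector[OF assms(1)] by (simp add: word_product_swap)
  moreover have "word_product \<alpha> moves (\<alpha> i) \<in> R"
    using play_vector[OF assms(1)] word_product_root simple_is_root assms(3) by blast
  ultimately show ?thesis
    using assms(2,3) by (simp add: unhappy_iff positive_coweight_iff)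
qed

lemma play_inversions:
  assumes "game_play n (\<lambda>i. coroot (\<alpha> i)) j moves c" "j \<in> {1..n}"
  shows "inversion_set R n \<alpha> (word_product \<alpha> (rev moves)) \<subseteq> P - parabolic_positive_roots R n \<alpha> j
    \<and> card (inversion_set R n \<alpha> (word_product \<alpha> (rev moves))) = length moves"
  using assms
proof induction
  case game_start
  have "inversion_set R n \<alpha> id = {}"
    using not_positive_and_negative by (auto simp: inversion_iff)
  then show ?case by (simp add: id_def)
next
  case (game_step "is" c i c')
  have i: "i \<in> {1..n}" and u: "unhappy n (\<lambda>i. coroot (\<alpha> i)) j c i"
    using game_step.hyps(2) by (auto simp: game_move_def unhappy_def)
  have b: "word_product \<alpha> is (\<alpha> i) \<in> P - parabolic_positive_roots R n \<alpha> j"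
    using unhappy_after_play_iff[OF game_step.hyps(1) game_step.prems i] u by blast
  have s: "set (rev is) \<subseteq> {1..n}" using play_vector[OF game_step.hyps(1)] by simp
  show ?case
    using inversion_set_extend[OF i s] b game_step.IH[OF game_step.prems]
    by (simp add: finite_inversion_set comp_def)
qed

text \<open>Along a reduced expression, read from the right, inversions are only ever added.  So every
  tail again represents an element without inversions in \<open>R\<^sub>j\<^sup>+\<close>, and each added root is an
  inversion of \<open>w\<close>, hence outside \<open>R\<^sub>j\<^sup>+\<close>.\<close>
lemma reduced_expression_played:
  assumes "j \<in> {1..n}" "reduced_expression n \<alpha> ks w"
    and "inversion_set R n \<alpha> w \<subseteq> P - parabolic_positive_roots R n \<alpha> j"
  shows "\<exists>c. game_play n (\<lambda>i. coroot (\<alpha> i)) j (rev ks) c"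
  using assms(2,3)
proof (induction ks arbitrary: w)
  case Nil
  then show ?case by (auto intro: game_start)
next
  case (Cons i ks)
  have ks: "i \<in> {1..n}" "set ks \<subseteq> {1..n}" "w = word_product \<alpha> (i # ks)"
    using Cons.prems(1) by (auto simp: reduced_expression_def)
  let ?\<beta> = "word_product \<alpha> (rev ks) (\<alpha> i)"
  have I: "inversion_set R n \<alpha> w = insert ?\<beta> (inversion_set R n \<alpha> (word_product \<alpha> ks))"
    using inversion_set_extend(1)[OF ks(1,2)] reduced_expression_Cons_positive[OF Cons.prems(1)]
      ks(3) by simp
  then obtain c where c: "game_play n (\<lambda>i. coroot (\<alpha> i)) j (rev ks) c"
    using Cons.IH[OF reduced_expression_tail[OF Cons.prems(1)]] Cons.prems(2) by blast
  have "unhappy n (\<lambda>i. coroot (\<alpha> i)) j c i"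
    using unhappy_after_play_iff[OF c assms(1) ks(1)] I Cons.prems(2) by blast
  then obtain c' where "game_move n (\<lambda>i. coroot (\<alpha> i)) j c i c'" by (rule unhappy_moves)
  with c show ?case by (auto intro: game_step)
qed

end

theorem theorem3p19:
  fixes R :: "'a::euclidean_space set" and \<alpha> :: "nat \<Rightarrow> 'a" and n j :: nat
  assumes "root_system R"
    and "simple_roots R n \<alpha>"
    and "j \<in> {1..n}"
  shows "(\<forall>moves c. game_play n (\<lambda>i. coroot (\<alpha> i)) j moves c \<longrightarrow>
            (\<exists>w \<in> minimal_representatives R n \<alpha> j. reduced_expression n \<alpha> (rev moves) w)) \<and>
         (\<forall>w \<in> minimal_representatives R n \<alpha> j. \<forall>ks. reduced_expression n \<alpha> ks w \<longrightarrow>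
            (\<exists>moves c. game_play n (\<lambda>i. coroot (\<alpha> i)) j moves c \<and> ks = rev moves))"
proof -
  interpret based_root_system R n \<alpha> using assms by unfold_locales
  show ?thesis
  proof (intro conjI allI ballI impI)
    fix moves c assume play: "game_play n (\<lambda>i. coroot (\<alpha> i)) j moves c"
    let ?w = "word_product \<alpha> (rev moves)"
    have s: "set (rev moves) \<subseteq> {1..n}" using play_vector[OF play] by simp
    note inv = play_inversions[OF play assms(3)]
    have "?w \<in> minimal_representatives R n \<alpha> j"
      using inv word_product_in_weyl_group[OF s] by (simp add: minimal_representatives_def)
    moreover have "reduced_expression n \<alpha> (rev moves) ?w"
      using inversions_reduced[OF s] inv by simp
    ultimately show "\<exists>w \<in> minimal_representatives R n \<alpha> j. reduced_expression n \<alpha> (rev moves) w"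
      by blast
  next
    fix w ks assume "w \<in> minimal_representatives R n \<alpha> j" "reduced_expression n \<alpha> ks w"
    then obtain c where "game_play n (\<lambda>i. coroot (\<alpha> i)) j (rev ks) c"
      using reduced_expression_played[OF assms(3)] unfolding minimal_representatives_def by blast
    then show "\<exists>moves c. game_play n (\<lambda>i. coroot (\<alpha> i)) j moves c \<and> ks = rev moves"
      by (metis rev_rev_ident)
  qed
qed

end
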